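(* Let $n\ge1$ and $\epsilon\ge0$. Let $X_1$ be the unique positive definite solution of $$A'X+XA-XBR^{-1}B'X+Q=0 .$$ Then the unique positive definite solution of $$A_n'X+XA_n-X\,nB_nR_n^{-1}B_n'\,X+\frac1nQ_n=0$$ is $X_n=\frac1n I_n\otimes X_1$. The corresponding optimal controller for the group, $u=-(nR_n^{-1}B_n'X_n)x$, equals $u=-(I_n\otimes R^{-1}B'X_1)\,x$ (it is decoupled across agents), and the optimal LQG cost per agent with perfect state measurements, $J^*(0,n)=\mathrm{Tr}\left((W_n+\epsilon Z_n)X_n\right)$, is independent of the number of agents: $$J^*(0,n)=\mathrm{Tr}\left((W+\epsilon Z)X_1\right)=J^*(0,1).$$
   Context: Primes denote transposes and $\otimes$ is the Kronecker product. $A\in\mathbb{R}^{d\times d}$, $B\in\mathbb{R}^{d\times m}$, $F,G\in\mathbb{R}^{d\times d}$, $W=GG'$, $Z=FF'$; $Q\in\mathbb{R}^{d\times d}$ is symmetric positive semidefinite, $R\in\mathbb{R}^{m\times m}$ is symmetric positive definite; $(A,B)$ is controllable and $(A,Q)$ is observable. Positive definite matrices are symmetric. $I_n$ is the $n\times n$ identity, $\mathbf 1_n$ the column vector of $n$ ones, $E_n=\mathbf 1_n\mathbf 1_n'$; $A_n=I_n\otimes A$, $B_n=I_n\otimes B$, $F_n=I_n\otimes F$, $Z_n=I_n\otimes Z$, $Q_n=I_n\otimes Q$, $R_n=I_n\otimes R$, $G_n=\mathbf 1_n\otimes G$, $W_n=E_n\otimes W$. The LQG tracking problem with perfect state measurements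 is to minimize $\lim_{T\to\infty}\frac1T\mathbb{E}\int_0^T\frac1n(x'Q_nx+u'R_nu)\,dt$ for the relative dynamics $\dot x=A_nx+B_nu+\sqrt\epsilon F_nw_p-G_nw_e$, where $w_p$, $w_e$ are independent standard white Gaussian noises and the controller observes $x$. Here $x=[x_1',\dots,x_n']'$ with $x_i\in\mathbb{R}^d$ the difference between the state of agent $i$ and that of the target, and $u$ stacks the agents' controls. Its optimal control is $u=-(nR_n^{-1}B_n'X_n)x$ and its optimal cost is $J^*(0,n)=\mathrm{Tr}((W_n+\epsilon Z_n)X_n)$, with $X_n$ the positive definite solution of the $n$-agent Riccati equation in the claim. *)

theory Defs
  imports "HOL-Analysis.Analysis"
begin

definition pos_semidef :: "real^'k^'k \<Rightarrow> bool" where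
  "pos_semidef M \<longleftrightarrow> transpose M = M \<and> (\<forall>x. 0 \<le> x \<bullet> (M *v x))"

definition pos_def :: "real^'k^'k \<Rightarrow> bool" where
  "pos_def M \<longleftrightarrow> transpose M = M \<and> (\<forall>x. x \<noteq> 0 \<longrightarrow> 0 < x \<bullet> (M *v x))"

definition trajectory ::
  "real^'d^'d \<Rightarrow> real^'m^'d \<Rightarrow> real \<Rightarrow> (real \<Rightarrow> real^'m) \<Rightarrow> (real \<Rightarrow> real^'d) \<Rightarrow> bool" where
  "trajectory A B T u x \<longleftrightarrow>
     (\<forall>t\<in>{0..T}. (x has_vector_derivative (A *v x t + B *v u t)) (at t within {0..T}))"

definition controllable :: "real^'d^'d \<Rightarrow> real^'m^'d \<Rightarrow> bool" where
  "controllable A B \<longleftrightarrow>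
     (\<forall>x0 x1. \<exists>T>0. \<exists>u x. continuous_on {0..T} u \<and> trajectory A B T u x \<and> x 0 = x0 \<and> x T = x1)"

(* The initial state is determined by the output C x on some finite interval. By linearity it
   does not matter whether a known input is present, so the input-free system is used. *)
definition observable :: "real^'d^'d \<Rightarrow> real^'d^'p \<Rightarrow> bool" where
  "observable A C \<longleftrightarrow>
     (\<exists>T>0. \<forall>x y.
        (\<forall>t\<in>{0..T}. (x has_vector_derivative (A *v x t)) (at t within {0..T})) \<and>
        (\<forall>t\<in>{0..T}. (y has_vector_derivative (A *v y t)) (at t within {0..T})) \<and>
        (\<forall>t\<in>{0..T}. C *v x t = C *v y t) \<longrightarrow> x 0 = y 0)"

definition pd_riccati_solution ::
  "real^'k^'k \<Rightarrow> real^'k^'k \<Rightarrow> real^'k^'k \<Rightarrow> real^'k^'k \<Rightarrow> bool" where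
  "pd_riccati_solution A S Q X \<longleftrightarrow>
     pos_def X \<and> transpose A ** X + X ** A - X ** S ** X + Q = 0"

definition unique_pd_riccati_solution ::
  "real^'k^'k \<Rightarrow> real^'k^'k \<Rightarrow> real^'k^'k \<Rightarrow> real^'k^'k \<Rightarrow> bool" where
  "unique_pd_riccati_solution A S Q X \<longleftrightarrow>
     pd_riccati_solution A S Q X \<and> (\<forall>Y. pd_riccati_solution A S Q Y \<longrightarrow> Y = X)"

(* Block (i, j) of the product is M $ i $ j times N: the first component of an index is the
   block (the agent), the second the position inside the block. *)
definition kron :: "real^'b^'a \<Rightarrow> real^'e^'c \<Rightarrow> real^('b \<times> 'e)^('a \<times> 'c)"  (infixr "\<otimes>\<^sub>K" 75) where
  "M \<otimes>\<^sub>K N = (\<chi> p q. M $ fst p $ fst q * N $ snd p $ snd q)"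

definition ones_col :: "real^1^'n" where
  "ones_col = (\<chi> i j. 1)"

definition ones_mat :: "real^'n^'n" where
  "ones_mat = ones_col ** transpose ones_col"

definition agent_block :: "'n::finite \<Rightarrow> real^('n \<times> 'k::finite) \<Rightarrow> real^'k" where
  "agent_block i x = (\<chi> k. x $ (i, k))"

(* The agents are the elements of the finite type 'n, so n = CARD('n). *)

definition group_S :: "real^'m^'d \<Rightarrow> real^'m^'m \<Rightarrow> real^('n::finite \<times> 'd)^('n \<times> 'd)" where
  "group_S B R =
     (let Bn = (mat 1 :: real^'n^'n) \<otimes>\<^sub>K B; Rn = (mat 1 :: real^'n^'n) \<otimes>\<^sub>K R
      in real CARD('n) *\<^sub>R (Bn ** matrix_inv Rn ** transpose Bn))"

definition group_Q :: "real^'d^'d \<Rightarrow> real^('n::finite \<times> 'd)^('n \<times> 'd)" where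
  "group_Q Q = (1 / real CARD('n)) *\<^sub>R ((mat 1 :: real^'n^'n) \<otimes>\<^sub>K Q)"

definition group_X ::
  "real^'d^'d \<Rightarrow> real^'m^'d \<Rightarrow> real^'d^'d \<Rightarrow> real^'m^'m \<Rightarrow> real^('n::finite \<times> 'd)^('n \<times> 'd)" where
  "group_X A B Q R =
     (THE X. pd_riccati_solution ((mat 1 :: real^'n^'n) \<otimes>\<^sub>K A) (group_S B R) (group_Q Q) X)"

(* Optimal state feedback u = -(n Rn^-1 Bn' Xn) x of the n-agent tracking problem
     minimize  lim (1/T) E (integral over [0,T] of (1/n) (x' Qn x + u' Rn u))
     subject to  dx/dt = An x + Bn u + sqrt eps Fn wp - Gn we,  x observed exactly,
   with wp, we independent standard white Gaussian noises. *)
definition optimal_control ::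
  "real^'d^'d \<Rightarrow> real^'m^'d \<Rightarrow> real^'d^'d \<Rightarrow> real^'m^'m \<Rightarrow> real^('n::finite \<times> 'd) \<Rightarrow> real^('n \<times> 'm)" where
  "optimal_control A B Q R x =
     (let Bn = (mat 1 :: real^'n^'n) \<otimes>\<^sub>K B; Rn = (mat 1 :: real^'n^'n) \<otimes>\<^sub>K R
      in - ((real CARD('n) *\<^sub>R (matrix_inv Rn ** transpose Bn ** group_X A B Q R)) *v x))"

(* J*(0,n), the optimal cost of the same problem, given by its standard trace formula
   Tr ((Wn + eps Zn) Xn). *)
definition optimal_cost ::
  "'n::finite itself \<Rightarrow> real^'d^'d \<Rightarrow> real^'m^'d \<Rightarrow> real^'d^'d \<Rightarrow> real^'d^'d \<Rightarrow> real^'d^'d \<Rightarrow> real^'m^'m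
     \<Rightarrow> real \<Rightarrow> real" where
  "optimal_cost _ A B F G Q R \<epsilon> =
     (let W = G ** transpose G; Z = F ** transpose F;
          Wn = (ones_mat :: real^'n^'n) \<otimes>\<^sub>K W; Zn = (mat 1 :: real^'n^'n) \<otimes>\<^sub>K Z
      in trace ((Wn + \<epsilon> *\<^sub>R Zn) ** group_X A B Q R))"

end

theory Submission imports Defs begin

text \<open>
  If X and Y are positive definite Riccati solutions and D = X - Y has a direction with v'Dv > 0,
  let \<mu> > 0 be the maximum of the Rayleigh quotient v'Dv / v'Xv. For v in
  E = {v. Dv = \<mu>Xv}, the two equations combine to (1 - \<mu>) v'XSXv + v'Qv = 0, and \<mu> < 1
  since Y is positive definite. Hence Qv = 0 and SXv = 0, which makes E invariant under A;
  a nonzero A-invariant subspace in the kernel of Q contradicts observability.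
  For the group problem the agent blocks of E are A-invariant and in the kernel of Q, so
  observability of (A, Q) gives uniqueness there as well.
\<close>

section \<open>Null vectors of semidefinite forms, and unobservable invariant sets\<close>

text \<open>Along the line \<open>x - t *\<^sub>R y\<close> with \<open>y = M *v x\<close> the form
  is a quadratic in t with no constant term and slope -2 (y . y) at 0. It would be negative for
  small t > 0 unless y = 0.\<close>

lemma psd_null_vector:
  fixes M :: "real^'k^'k"
  assumes "pos_semidef M" and "x \<bullet> (M *v x) = 0"
  shows "M *v x = 0"
proof -
  have sym: "transpose M = M" and nn: "\<And>x. 0 \<le> x \<bullet> (M *v x)"
    using assms by (auto simp: pos_semidef_def)
  define y where "y = M *v x"
  define b where "b = y \<bullet> (M *v y)"
  have xy: "x \<bullet> (M *v y) = y \<bullet> y"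
    by (metis dot_matrix_vector_mul inner_commute sym y_def vector_transpose_matrix transpose_matrix_vector dot_lmul_matrix)
  have key: "0 \<le> - (2 * t * (y \<bullet> y)) + t\<^sup>2 * b" for t
  proof -
    have "0 \<le> (x - t *\<^sub>R y) \<bullet> (M *v (x - t *\<^sub>R y))" by (rule nn)
    also have "\<dots> = - (2 * t * (y \<bullet> y)) + t\<^sup>2 * b"
      using assms(2) xy
      by (simp add: matrix_vector_mult_diff_distrib matrix_vector_mult_scaleR inner_diff_left
          inner_diff_right b_def power2_eq_square y_def[symmetric] algebra_simps)
    finally show ?thesis .
  qed
  have "b \<ge> 0" unfolding b_def by (rule nn)
  have "y \<bullet> y \<le> 0"
  proof (rule ccontr)
    assume "\<not> y \<bullet> y \<le> 0"
    then have p: "0 < y \<bullet> y" by linarith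
    \<comment> \<open>This size makes the quadratic term at most t (y . y), half of the linear term.
      The +1 covers b = 0.\<close>
    define t where "t = (y \<bullet> y) / (b + 1)"
    have t: "0 < t" using p \<open>b \<ge> 0\<close> by (simp add: t_def)
    have "t * b \<le> t * (b + 1)" using t by simp
    also have "\<dots> = y \<bullet> y" using \<open>b \<ge> 0\<close> by (simp add: t_def)
    finally have "t * (t * b) \<le> t * (y \<bullet> y)" using t by simp
    moreover have "0 < t * (y \<bullet> y)" using t p by simp
    ultimately show False using key[of t] by (simp add: power2_eq_square)
  qed
  then show ?thesis by (metis inner_gt_zero_iff linorder_not_le y_def)
qed

text \<open>All iterates of w under A stay in \<open>V\<close>, so the output along the trajectory
  through w is a power series with zero coefficients. Observability then identifies w with the
  initial state 0 of the zero trajectory.\<close>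

lemma observable_invariant_kernel:
  fixes A :: "real^'d^'d" and C :: "real^'d^'p"
  assumes obs: "observable A C"
    and inv: "\<And>v. v \<in> V \<Longrightarrow> A *v v \<in> V" and ker: "\<And>v. v \<in> V \<Longrightarrow> C *v v = 0"
    and "w \<in> V"
  shows "w = 0"
proof -
  \<comment> \<open>The trajectory through w is exp (t A) w, as a componentwise power series.\<close>
  define a where "a k = ((*v) A ^^ k) w" for k
  have a_Suc: "a (Suc k) = A *v a k" for k by (simp add: a_def)
  have aV: "a k \<in> V" for k
    by (induction k) (simp_all add: a_Suc inv, simp add: a_def \<open>w \<in> V\<close>)
  obtain K where K: "0 < K" "\<And>x. norm (A *v x) \<le> norm x * K"
    using bounded_linear.pos_bounded[OF matrix_vector_mul_bounded_linear[of A]] by blast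
  have a_le: "norm (a k) \<le> K ^ k * norm w" for k
  proof (induction k)
    case (Suc k)
    have "norm (a (Suc k)) \<le> norm (a k) * K" by (simp add: a_Suc K)
    also have "\<dots> \<le> K ^ k * norm w * K" using Suc K by (simp add: mult_right_mono)
    finally show ?case by (simp add: ac_simps)
  qed (simp add: a_def)
  define c where "c i k = a k $ i / fact k" for i k
  have summ: "summable (\<lambda>k. c i k * t ^ k)" for i t
  proof (rule summable_comparison_test)
    show "\<exists>N. \<forall>k\<ge>N. norm (c i k * t ^ k) \<le> norm w * (inverse (fact k) * (K * \<bar>t\<bar>) ^ k)"
    proof (intro exI[of _ 0] allI impI)
      fix k :: nat
      have "\<bar>a k $ i\<bar> \<le> K ^ k * norm w" using a_le[of k] component_le_norm_cart[of "a k" i] by linarith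
      then have "\<bar>a k $ i\<bar> * (\<bar>t\<bar> ^ k / fact k) \<le> K ^ k * norm w * (\<bar>t\<bar> ^ k / fact k)"
        by (rule mult_right_mono) simp
      then show "norm (c i k * t ^ k) \<le> norm w * (inverse (fact k) * (K * \<bar>t\<bar>) ^ k)"
        by (simp add: c_def abs_mult power_abs field_simps)
    qed
    show "summable (\<lambda>k. norm w * (inverse (fact k) * (K * \<bar>t\<bar>) ^ k))"
      by (intro summable_mult summable_exp)
  qed
  define x where "x t = (\<chi> i. \<Sum>k. c i k * t ^ k)" for t :: real
  \<comment> \<open>A matrix may be applied term by term. This serves for \<open>A\<close> in the
    derivative and for \<open>C\<close> in the output.\<close>
  have mult: "(M *v x t) $ i = (\<Sum>k. (M *v a k) $ i / fact k * t ^ k)" for M :: "real^'d^'q" and i t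
  proof -
    have "(M *v x t) $ i = (\<Sum>j\<in>UNIV. \<Sum>k. M $ i $ j * (c j k * t ^ k))"
      by (simp add: matrix_vector_mult_def x_def suminf_mult[OF summ])
    also have "\<dots> = (\<Sum>k. \<Sum>j\<in>UNIV. M $ i $ j * (c j k * t ^ k))"
      by (rule suminf_sum[symmetric]) (intro summable_mult summ)
    also have "\<dots> = (\<Sum>k. (M *v a k) $ i / fact k * t ^ k)"
      by (simp add: matrix_vector_mult_def c_def sum_distrib_left sum_distrib_right sum_divide_distrib ac_simps)
    finally show ?thesis .
  qed
  have deriv: "(x has_vector_derivative A *v x t) (at t within T)" for t T
  proof -
    have "((\<lambda>t. x t $ i) has_real_derivative (A *v x t) $ i) (at t)" for i
    proof -
      have "((\<lambda>t. \<Sum>k. c i k * t ^ k) has_real_derivative (\<Sum>k. diffs (c i) k * t ^ k)) (at t)"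
        by (rule termdiffs_strong_converges_everywhere) (rule summ)
      \<comment> \<open>The factor k+1 from differentiation cancels against the factorial of k+1,
        leaving the series of \<open>A *v x t\<close>.\<close>
      moreover have "diffs (c i) = (\<lambda>k. (A *v a k) $ i / fact k)"
        by (rule ext) (simp add: diffs_def c_def a_Suc del: of_nat_Suc)
      ultimately show ?thesis by (simp only: mult) (simp add: x_def)
    qed
    then have "(x has_vector_derivative A *v x t) (at t)"
      unfolding has_vector_derivative_def has_real_derivative_iff_has_vector_derivative
      by (subst has_derivative_componentwise_within) (auto simp: Basis_vec_def inner_axis)
    then show ?thesis by (rule has_vector_derivative_at_within)
  qed
  have x0: "x 0 = w"
    by (simp only: x_def powser_zero) (simp add: c_def vec_eq_iff a_def)
  have Cx: "C *v x t = 0" for t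
    by (simp add: vec_eq_iff mult ker aV)
  obtain T where T: "\<And>x y.
        (\<forall>t\<in>{0..T}. (x has_vector_derivative (A *v x t)) (at t within {0..T})) \<and>
        (\<forall>t\<in>{0..T}. (y has_vector_derivative (A *v y t)) (at t within {0..T})) \<and>
        (\<forall>t\<in>{0..T}. C *v x t = C *v y t) \<longrightarrow> x 0 = y 0"
    using obs unfolding observable_def by blast
  have "x 0 = (\<lambda>_. 0) (0::real)"
    by (rule mp[OF T]) (simp add: deriv Cx)
  then show ?thesis by (simp add: x0)
qed

section \<open>Comparison of two Riccati solutions\<close>

text \<open>Applied in both orders, this gives uniqueness. Observability enters as the absence of
  nonzero vectors in invariant sets inside the kernel of \<open>Q\<close>, a form that can be
  checked agent by agent for the group system.\<close>

lemma riccati_solution_le: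
  fixes A S Q X Y :: "real^'k^'k"
  assumes S: "pos_semidef S" and Q: "pos_semidef Q"
    and X: "pd_riccati_solution A S Q X" and Y: "pd_riccati_solution A S Q Y"
    and obs: "\<And>V w. \<lbrakk>\<And>v. v \<in> V \<Longrightarrow> A *v v \<in> V; \<And>v. v \<in> V \<Longrightarrow> Q *v v = 0; w \<in> V\<rbrakk> \<Longrightarrow> w = 0"
  shows "u \<bullet> (X *v u) \<le> u \<bullet> (Y *v u)"
proof (rule ccontr)
  assume neg: "\<not> u \<bullet> (X *v u) \<le> u \<bullet> (Y *v u)"
  have tX: "transpose X = X" and pX: "\<And>v. v \<noteq> 0 \<Longrightarrow> 0 < v \<bullet> (X *v v)"
    and rX: "transpose A ** X + X ** A - X ** S ** X + Q = 0"
    and tY: "transpose Y = Y" and pY: "\<And>v. v \<noteq> 0 \<Longrightarrow> 0 < v \<bullet> (Y *v v)"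
    and rY: "transpose A ** Y + Y ** A - Y ** S ** Y + Q = 0"
    using X Y by (auto simp: pd_riccati_solution_def pos_def_def)
  have eX: "transpose A *v (X *v v) + X *v (A *v v) - X *v (S *v (X *v v)) + Q *v v = 0" for v
    using arg_cong[OF rX, of "\<lambda>M. M *v v"]
    by (simp add: matrix_vector_mult_add_rdistrib matrix_vector_mult_diff_rdistrib matrix_vector_mul_assoc matrix_mul_assoc)
  have eY: "transpose A *v (Y *v v) + Y *v (A *v v) - Y *v (S *v (Y *v v)) + Q *v v = 0" for v
    using arg_cong[OF rY, of "\<lambda>M. M *v v"]
    by (simp add: matrix_vector_mult_add_rdistrib matrix_vector_mult_diff_rdistrib matrix_vector_mul_assoc matrix_mul_assoc)
  have mv: "a \<bullet> (transpose M *v b) = (M *v a) \<bullet> b" for a b and M :: "real^'k^'k"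
    by (metis dot_lmul_matrix transpose_matrix_vector transpose_transpose)
  have sX: "a \<bullet> (X *v b) = (X *v a) \<bullet> b" for a b using mv[of a X b] tX by simp
  define q where "q v = v \<bullet> ((X - Y) *v v) / (v \<bullet> (X *v v))" for v
  have u0: "u \<noteq> 0" using neg by auto
  have "continuous_on (sphere 0 1) q"
    unfolding q_def using pX
    by (intro continuous_intros matrix_vector_mult_linear_continuous_on) (metis norm_zero mem_sphere_0 zero_neq_one less_irrefl)
  moreover have "sphere (0::real^'k) 1 \<noteq> {}" by simp
  ultimately obtain m where m: "norm m = 1" "\<And>v. norm v = 1 \<Longrightarrow> q v \<le> q m"
    using continuous_attains_sup[OF compact_sphere, of 0 1 q] by auto
  define \<mu> where "\<mu> = q m"
  have m0: "m \<noteq> 0" using m by auto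
  \<comment> \<open>The quotient is invariant under scaling, so its maximum on the unit sphere
    bounds it at every nonzero vector.\<close>
  have qle: "q v \<le> \<mu>" if "v \<noteq> 0" for v
  proof -
    have "q v = q (v /\<^sub>R norm v)"
      using that by (simp add: q_def matrix_vector_mult_scaleR)
    also have "\<dots> \<le> \<mu>" unfolding \<mu>_def using that by (intro m) simp
    finally show ?thesis .
  qed
  have "0 < q u"
    using neg pX[OF u0] by (simp add: q_def matrix_vector_mult_diff_rdistrib inner_diff_right)
  then have mu0: "0 < \<mu>" using qle[OF u0] by simp
  define E where "E = {v. X *v v - Y *v v = \<mu> *\<^sub>R (X *v v)}"
  \<comment> \<open>Maximality of \<mu> makes this matrix semidefinite, and its form vanishes at the
    maximizer m. Hence m lies in its kernel, which is \<open>E\<close>.\<close>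
  let ?M = "\<mu> *\<^sub>R X - (X - Y)"
  have "pos_semidef ?M"
    unfolding pos_semidef_def
  proof (intro conjI allI)
    show "transpose ?M = ?M"
      using tX tY by (simp add: transpose_def vec_eq_iff)
    fix v :: "real^'k"
    show "0 \<le> v \<bullet> (?M *v v)"
    proof (cases "v = 0")
      case False
      then show ?thesis using qle[OF False] pX[OF False]
        by (simp add: q_def divide_le_eq matrix_vector_mult_diff_rdistrib inner_diff_right scaleR_matrix_vector_assoc[symmetric])
    qed simp
  qed
  moreover have "m \<bullet> (?M *v m) = 0"
    using pX[OF m0] by (simp add: \<mu>_def q_def matrix_vector_mult_diff_rdistrib inner_diff_right scaleR_matrix_vector_assoc[symmetric])
  ultimately have "?M *v m = 0" by (rule psd_null_vector)
  then have mE: "m \<in> E"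
    by (simp add: E_def matrix_vector_mult_diff_rdistrib scaleR_matrix_vector_assoc[symmetric])
  have Yv: "Y *v v = (1 - \<mu>) *\<^sub>R (X *v v)" if "v \<in> E" for v
    using that by (simp add: E_def algebra_simps)
  have mu1: "\<mu> < 1"
    using pX[OF m0] pY[OF m0] by (simp add: Yv[OF mE] zero_less_mult_iff)
  have ker: "Q *v v = 0 \<and> S *v (X *v v) = 0" if v: "v \<in> E" for v
  proof -
    let ?s = "(X *v v) \<bullet> (S *v (X *v v))" and ?r = "v \<bullet> (Q *v v)"
    have 1: "2 * ((X *v v) \<bullet> (A *v v)) - ?s + ?r = 0"
      using arg_cong[OF eX[of v], of "\<lambda>y. v \<bullet> y"]
      by (simp add: inner_add_right inner_diff_right mv sX[of v] inner_commute[of "A *v v"] del: transpose_matrix_vector)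
    have 2: "2 * (1 - \<mu>) * ((X *v v) \<bullet> (A *v v)) - (1 - \<mu>)\<^sup>2 * ?s + ?r = 0"
    proof -
      have sY: "a \<bullet> (Y *v b) = (Y *v a) \<bullet> b" for a b using mv[of a Y b] tY by simp
      have "2 * ((1 - \<mu>) * ((X *v v) \<bullet> (A *v v))) - (1 - \<mu>) * ((1 - \<mu>) * ?s) + ?r = 0"
        using arg_cong[OF eY[of v], of "\<lambda>y. v \<bullet> y"]
        by (simp add: inner_add_right inner_diff_right mv sY[of v] Yv[OF v] matrix_vector_mult_scaleR
            inner_commute[of "A *v v"] del: transpose_matrix_vector)
      then show ?thesis by (simp only: power2_eq_square mult.assoc)
    qed
    \<comment> \<open>Subtracting 1 - \<mu> times equation \<open>1\<close> from equation
      \<open>2\<close> eliminates the term containing \<open>A\<close>.\<close>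
    have "\<mu> * ((1 - \<mu>) * ?s + ?r) = 0"
    proof -
      have "\<mu> * ((1 - \<mu>) * s + r) = 2 * (1 - \<mu>) * a - (1 - \<mu>)\<^sup>2 * s + r - (1 - \<mu>) * (2 * a - s + r)" for a s r
        by (simp add: power2_eq_square algebra_simps)
      from this[of ?s ?r "(X *v v) \<bullet> (A *v v)"] show ?thesis by (simp only: 1 2 mult_zero_right diff_zero)
    qed
    then have 3: "(1 - \<mu>) * ?s + ?r = 0" using mu0 by simp
    have s: "0 \<le> ?s" and r: "0 \<le> ?r" using S Q by (simp_all add: pos_semidef_def)
    have "0 \<le> (1 - \<mu>) * ?s" using s mu1 by simp
    then have "?r = 0" "(1 - \<mu>) * ?s = 0" using 3 r by linarith+
    then show ?thesis using psd_null_vector[OF S] psd_null_vector[OF Q] mu1 by auto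
  qed
  \<comment> \<open>With the \<open>S\<close> and \<open>Q\<close> terms gone, both equations
    express their remaining term through \<open>transpose A *v (X *v v)\<close>. Eliminating that
    vector gives the defining relation of \<open>E\<close> at \<open>A *v v\<close>.\<close>
  have inv: "A *v v \<in> E" if v: "v \<in> E" for v
  proof -
    have 1: "transpose A *v (X *v v) + X *v (A *v v) = 0"
      using eX[of v] ker[OF v] by simp
    have 2: "(1 - \<mu>) *\<^sub>R (transpose A *v (X *v v)) + Y *v (A *v v) = 0"
      using eY[of v] ker[OF v] by (simp add: Yv[OF v] matrix_vector_mult_scaleR)
    have "Y *v (A *v v) = (1 - \<mu>) *\<^sub>R (X *v (A *v v))"
    proof -
      have "X *v (A *v v) = - (transpose A *v (X *v v))"
        using 1 by (rule minus_unique[symmetric])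
      moreover have "Y *v (A *v v) = - ((1 - \<mu>) *\<^sub>R (transpose A *v (X *v v)))"
        using 2 by (rule minus_unique[symmetric])
      ultimately show ?thesis by (simp only: scaleR_minus_right)
    qed
    then show ?thesis by (simp add: E_def algebra_simps)
  qed
  have "m = 0" using obs[of E m] inv ker mE by blast
  then show False using m0 by simp
qed

section \<open>Kronecker products and agent blocks\<close>

lemma kron_mult: "(M \<otimes>\<^sub>K N) ** (P \<otimes>\<^sub>K K) = (M ** P) \<otimes>\<^sub>K (N ** K)"
  \<comment> \<open>Reading the index type as a Cartesian product turns the sum over pairs into the
    double sum produced by \<open>sum_product\<close>.\<close>
  by (simp add: vec_eq_iff kron_def matrix_matrix_mult_def sum_product
      sum.cartesian_product UNIV_Times_UNIV[symmetric] case_prod_beta ac_simps del: UNIV_Times_UNIV)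

lemma transpose_kron: "transpose (M \<otimes>\<^sub>K N) = transpose M \<otimes>\<^sub>K transpose N"
  by (simp add: vec_eq_iff kron_def transpose_def)

lemma trace_kron: "trace (M \<otimes>\<^sub>K N) = trace M * trace N"
  by (simp add: kron_def trace_def sum_product
      sum.cartesian_product UNIV_Times_UNIV[symmetric] case_prod_beta del: UNIV_Times_UNIV)

lemma kron_mat_1: "(mat 1 :: real^'a^'a) \<otimes>\<^sub>K (mat 1 :: real^'b^'b) = mat 1"
  by (auto simp: vec_eq_iff kron_def mat_def prod_eq_iff)

lemma kron_add_right: "M \<otimes>\<^sub>K (N + P) = M \<otimes>\<^sub>K N + M \<otimes>\<^sub>K P"
  and kron_diff_right: "M \<otimes>\<^sub>K (N - P) = M \<otimes>\<^sub>K N - M \<otimes>\<^sub>K P"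
  and kron_zero_right: "M \<otimes>\<^sub>K 0 = 0"
  by (simp_all add: vec_eq_iff kron_def algebra_simps)

text \<open>A block-diagonal matrix acts on each agent separately. Quadratic forms, kernels,
  invariance and the controller are all reduced to one agent through this identity.\<close>

lemma agent_block_kron:
  fixes N :: "real^'e^'c"
  shows "agent_block i (((mat 1 :: real^'n^'n) \<otimes>\<^sub>K N) *v x) = N *v agent_block i x"
proof -
  have "(\<Sum>j\<in>UNIV. \<Sum>l\<in>UNIV. (if i = j then 1 else 0) * N $ k $ l * x $ (j, l))
      = (\<Sum>l\<in>UNIV. N $ k $ l * x $ (i, l))" for k
  proof -
    have "(\<Sum>j\<in>UNIV. \<Sum>l\<in>UNIV. (if i = j then 1 else 0) * N $ k $ l * x $ (j, l))
        = (\<Sum>j\<in>UNIV. if i = j then (\<Sum>l\<in>UNIV. N $ k $ l * x $ (j, l)) else 0)"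
      by (intro sum.cong) auto
    then show ?thesis by simp
  qed
  then show ?thesis
    by (simp add: vec_eq_iff agent_block_def kron_def mat_def matrix_vector_mult_def
        sum.cartesian_product UNIV_Times_UNIV[symmetric] case_prod_beta del: UNIV_Times_UNIV)
qed

lemma agent_block_eq_iff: "x = y \<longleftrightarrow> (\<forall>i. agent_block i x = agent_block i y)"
  by (auto simp: vec_eq_iff agent_block_def)

lemma agent_block_linear: "linear (agent_block i)"
  by (rule linearI) (simp_all add: vec_eq_iff agent_block_def)

lemma inner_agent_block: "x \<bullet> y = (\<Sum>i\<in>UNIV. agent_block i x \<bullet> agent_block i y)"
  by (simp add: inner_vec_def agent_block_def
        sum.cartesian_product UNIV_Times_UNIV[symmetric] case_prod_beta del: UNIV_Times_UNIV)

text \<open>The form is the sum of the single-agent forms over all blocks, and a nonzero vector has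
  a nonzero block.\<close>

lemma pos_def_kron_mat_1:
  assumes "pos_def X"
  shows "pos_def ((mat 1 :: real^'n^'n) \<otimes>\<^sub>K X)"
  unfolding pos_def_def
proof (intro conjI allI impI)
  show "transpose ((mat 1 :: real^'n^'n) \<otimes>\<^sub>K X) = mat 1 \<otimes>\<^sub>K X"
    using assms by (simp add: transpose_kron pos_def_def)
  fix x :: "real^('n \<times> 'a)" assume "x \<noteq> 0"
  have nn: "0 \<le> y \<bullet> (X *v y)" for y
    using assms by (cases "y = 0") (auto simp: pos_def_def intro: less_imp_le)
  obtain i where "agent_block i x \<noteq> 0"
    using \<open>x \<noteq> 0\<close> agent_block_eq_iff[of x 0] linear_0[OF agent_block_linear] by metis
  then have "0 < agent_block i x \<bullet> (X *v agent_block i x)"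
    using assms by (simp add: pos_def_def)
  then show "0 < x \<bullet> ((mat 1 \<otimes>\<^sub>K X) *v x)"
    unfolding inner_agent_block agent_block_kron
    by (intro sum_pos2[of _ i]) (simp_all add: nn)
qed

lemma pos_semidef_kron_mat_1:
  assumes "pos_semidef X"
  shows "pos_semidef ((mat 1 :: real^'n^'n) \<otimes>\<^sub>K X)"
  using assms
  by (auto simp: pos_semidef_def transpose_kron inner_agent_block agent_block_kron intro!: sum_nonneg)

section \<open>Scaling, inverses and congruence of definite matrices\<close>

lemma transpose_scaleR: "transpose (c *\<^sub>R M) = c *\<^sub>R transpose M" for M :: "real^'a^'b"
  by (simp add: vec_eq_iff transpose_def)

lemma pos_def_scaleR: "pos_def M \<Longrightarrow> 0 < c \<Longrightarrow> pos_def (c *\<^sub>R M)"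
  by (simp add: pos_def_def transpose_scaleR scaleR_matrix_vector_assoc[symmetric])

lemma pos_semidef_scaleR: "pos_semidef M \<Longrightarrow> 0 \<le> c \<Longrightarrow> pos_semidef (c *\<^sub>R M)"
  by (simp add: pos_semidef_def transpose_scaleR scaleR_matrix_vector_assoc[symmetric])

lemma pos_def_invertible:
  assumes "pos_def M"
  shows "invertible M"
proof -
  have "x = 0" if "M *v x = 0" for x
    using assms that by (metis pos_def_def inner_zero_right less_irrefl)
  then show ?thesis
    by (simp add: invertible_left_inverse matrix_left_invertible_ker)
qed

lemma matrix_inv_left: "invertible M \<Longrightarrow> matrix_inv M ** M = mat 1"
  and matrix_inv_right: "invertible M \<Longrightarrow> M ** matrix_inv M = mat 1"
  unfolding invertible_def matrix_inv_def by (metis (mono_tags, lifting) someI_ex)+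

lemma matrix_inv_eqI:
  fixes M N :: "real^'k^'k"
  assumes "M ** N = mat 1"
  shows "matrix_inv M = N"
proof -
  have "invertible M" using assms by (auto simp: invertible_right_inverse)
  then have "matrix_inv M ** M = mat 1" by (rule matrix_inv_left)
  then show ?thesis using assms by (metis matrix_mul_assoc matrix_mul_lid matrix_mul_rid)
qed

lemma matrix_inv_kron_mat_1:
  fixes M :: "real^'k^'k"
  assumes "invertible M"
  shows "matrix_inv ((mat 1 :: real^'n^'n) \<otimes>\<^sub>K M) = mat 1 \<otimes>\<^sub>K matrix_inv M"
  using assms by (intro matrix_inv_eqI) (simp add: kron_mult matrix_inv_right kron_mat_1)

text \<open>With y the inverse of \<open>R\<close> applied to \<open>transpose B *v x\<close>, the
  form at x equals the form of \<open>R\<close> at y.\<close>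

lemma pos_semidef_congruence_matrix_inv:
  fixes B :: "real^'m^'d"
  assumes "pos_def R"
  shows "pos_semidef (B ** matrix_inv R ** transpose B)"
  unfolding pos_semidef_def
proof (intro conjI allI)
  have inv: "invertible R" and sym: "transpose R = R"
    using assms pos_def_invertible by (auto simp: pos_def_def)
  \<comment> \<open>By symmetry of \<open>R\<close>, the transposed inverse is again a right inverse
    of \<open>R\<close>, so the inverse is symmetric.\<close>
  have "R ** transpose (matrix_inv R) = transpose (matrix_inv R ** R)"
    by (simp add: matrix_transpose_mul sym)
  then have "matrix_inv R = transpose (matrix_inv R)"
    using inv by (intro matrix_inv_eqI) (simp add: matrix_inv_left)
  then show "transpose (B ** matrix_inv R ** transpose B) = B ** matrix_inv R ** transpose B"
    by (simp add: matrix_transpose_mul matrix_mul_assoc)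
  fix x :: "real^'d"
  define y where "y = matrix_inv R *v (transpose B *v x)"
  have Ry: "R *v y = transpose B *v x"
    using inv by (simp add: y_def matrix_vector_mul_assoc matrix_mul_assoc matrix_inv_right)
  have "x \<bullet> ((B ** matrix_inv R ** transpose B) *v x) = x \<bullet> (B *v y)"
    by (simp add: y_def matrix_vector_mul_assoc matrix_mul_assoc del: transpose_matrix_vector)
  also have "\<dots> = y \<bullet> (R *v y)"
    by (metis Ry dot_lmul_matrix inner_commute transpose_matrix_vector)
  also have "\<dots> \<ge> 0"
    using assms by (cases "y = 0") (auto simp: pos_def_def intro: less_imp_le)
  finally show "0 \<le> x \<bullet> ((B ** matrix_inv R ** transpose B) *v x)" .
qed

text \<open>The difference has zero form, hence is semidefinite with every vector null;
  \<open>psd_null_vector\<close> takes the place of polarization.\<close>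

lemma sym_matrix_eqI:
  fixes X Y :: "real^'k^'k"
  assumes "transpose X = X" "transpose Y = Y" "\<And>u. u \<bullet> (X *v u) = u \<bullet> (Y *v u)"
  shows "X = Y"
proof -
  have "pos_semidef (X - Y)"
    using assms by (simp add: pos_semidef_def matrix_vector_mult_diff_rdistrib inner_diff_right)
      (simp add: transpose_def vec_eq_iff)
  then have "(X - Y) *v u = 0" for u
    by (rule psd_null_vector) (simp add: matrix_vector_mult_diff_rdistrib inner_diff_right assms)
  then show ?thesis
    by (simp add: matrix_eq matrix_vector_mult_diff_rdistrib)
qed

section \<open>The group Riccati equation, its cost and its controller\<close>

lemma group_S_eq:
  assumes "invertible R"
  shows "(group_S B R :: real^('n::finite \<times> 'd::finite)^('n \<times> 'd))
      = real CARD('n) *\<^sub>R ((mat 1 :: real^'n^'n) \<otimes>\<^sub>K (B ** matrix_inv R ** transpose B))"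
  using assms by (simp add: group_S_def matrix_inv_kron_mat_1 transpose_kron kron_mult)

text \<open>The candidate solves the equation by direct substitution. A competing solution is not
  known to be block diagonal, so it is compared with the candidate in both directions.\<close>

lemma unique_group_riccati_solution:
  fixes A Q X1 :: "real^'d^'d" and B :: "real^'m^'d" and R :: "real^'m^'m"
  assumes Q: "pos_semidef Q" and R: "pos_def R" and obs: "observable A Q"
    and X1: "pd_riccati_solution A (B ** matrix_inv R ** transpose B) Q X1"
  shows "unique_pd_riccati_solution ((mat 1 :: real^'n^'n) \<otimes>\<^sub>K A) (group_S B R) (group_Q Q)
           ((1 / real CARD('n)) *\<^sub>R (mat 1 \<otimes>\<^sub>K X1))"
proof -
  let ?I = "mat 1 :: real^'n^'n" and ?n = "real CARD('n)"
  let ?A = "?I \<otimes>\<^sub>K A" and ?S = "group_S B R :: real^('n \<times> 'd)^('n \<times> 'd)"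
  let ?Q = "group_Q Q :: real^('n \<times> 'd)^('n \<times> 'd)" and ?X = "(1 / ?n) *\<^sub>R (?I \<otimes>\<^sub>K X1)"
  define S where "S = B ** matrix_inv R ** transpose B"
  have S: "?S = ?n *\<^sub>R (?I \<otimes>\<^sub>K S)"
    unfolding S_def by (rule group_S_eq) (rule pos_def_invertible[OF R])
  have psdS: "pos_semidef ?S"
    unfolding S S_def
    by (intro pos_semidef_scaleR pos_semidef_kron_mat_1 pos_semidef_congruence_matrix_inv R) simp
  have psdQ: "pos_semidef ?Q"
    unfolding group_Q_def by (intro pos_semidef_scaleR pos_semidef_kron_mat_1 Q) simp
  have sol: "pd_riccati_solution ?A ?S ?Q ?X"
    unfolding pd_riccati_solution_def
  proof
    show "pos_def ?X"
      using X1 by (intro pos_def_scaleR pos_def_kron_mat_1) (simp_all add: pd_riccati_solution_def)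
    \<comment> \<open>In the quadratic term the factor n of the group \<open>S\<close> cancels one
      of the two factors 1/n, so 1/n comes out of the whole equation.\<close>
    have "transpose ?A ** ?X + ?X ** ?A - ?X ** ?S ** ?X + ?Q
        = (1 / ?n) *\<^sub>R (?I \<otimes>\<^sub>K (transpose A ** X1 + X1 ** A - X1 ** S ** X1 + Q))"
      by (simp add: S group_Q_def transpose_kron kron_mult kron_add_right kron_diff_right
          scalar_matrix_assoc[symmetric] matrix_scalar_ac scaleR_add_right scaleR_diff_right matrix_mul_assoc)
    then show "transpose ?A ** ?X + ?X ** ?A - ?X ** ?S ** ?X + ?Q = 0"
      using X1 by (simp add: pd_riccati_solution_def S_def kron_zero_right)
  qed
  have nonobs: "w = 0"
    if V: "\<And>v. v \<in> V \<Longrightarrow> ?A *v v \<in> V" "\<And>v. v \<in> V \<Longrightarrow> ?Q *v v = 0" and w: "w \<in> V" for V w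
  proof -
    \<comment> \<open>Taking block i intertwines the group matrix with \<open>A\<close>, so the
      image of \<open>V\<close> is again invariant. The nonzero factor 1/n in \<open>group_Q\<close>
      does not change the kernel.\<close>
    have "agent_block i w = 0" for i
    proof (rule observable_invariant_kernel[OF obs])
      show "A *v v \<in> agent_block i ` V" if "v \<in> agent_block i ` V" for v
        using that V(1) by (auto simp: agent_block_kron[symmetric])
      show "Q *v v = 0" if v: "v \<in> agent_block i ` V" for v
      proof -
        obtain y where y: "y \<in> V" "v = agent_block i y" using v by blast
        have "(?I \<otimes>\<^sub>K Q) *v y = 0"
          using V(2)[OF y(1)] by (simp add: group_Q_def scaleR_matrix_vector_assoc[symmetric])
        then show ?thesis
          using y(2) agent_block_kron[where N=Q and i=i and x=y] linear_0[OF agent_block_linear] by metis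
      qed
      show "agent_block i w \<in> agent_block i ` V" using w by blast
    qed
    then show ?thesis by (simp add: agent_block_eq_iff[of w] linear_0[OF agent_block_linear])
  qed
  have "Y = ?X" if Y: "pd_riccati_solution ?A ?S ?Q Y" for Y
  proof (rule sym_matrix_eqI)
    show "transpose Y = Y" "transpose ?X = ?X"
      using Y sol by (simp_all add: pd_riccati_solution_def pos_def_def)
    show "u \<bullet> (Y *v u) = u \<bullet> (?X *v u)" for u
    proof (rule antisym)
      show "u \<bullet> (Y *v u) \<le> u \<bullet> (?X *v u)"
        by (rule riccati_solution_le[OF psdS psdQ Y sol]) (fact nonobs)
      show "u \<bullet> (?X *v u) \<le> u \<bullet> (Y *v u)"
        by (rule riccati_solution_le[OF psdS psdQ sol Y]) (fact nonobs)
    qed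
  qed
  with sol show ?thesis unfolding unique_pd_riccati_solution_def by blast
qed

text \<open>\<open>group_X\<close> is a definite description, so evaluating it takes both existence
  and uniqueness.\<close>

lemma group_X_eq:
  fixes A Q X1 :: "real^'d^'d" and B :: "real^'m^'d" and R :: "real^'m^'m"
  assumes "pos_semidef Q" and "pos_def R" and "observable A Q"
    and "pd_riccati_solution A (B ** matrix_inv R ** transpose B) Q X1"
  shows "(group_X A B Q R :: real^('n \<times> 'd)^('n \<times> 'd))
           = (1 / real CARD('n)) *\<^sub>R ((mat 1 :: real^'n^'n) \<otimes>\<^sub>K X1)"
  unfolding group_X_def
  using unique_group_riccati_solution[OF assms, where 'n='n]
  unfolding unique_pd_riccati_solution_def by (intro the_equality) blast+

lemma matrix_add_mult_rdistrib: "(M + N) ** P = M ** P + N ** P"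
  by (simp add: matrix_matrix_mult_def vec_eq_iff distrib_right sum.distrib)

text \<open>The all-ones matrix and the identity both have trace n. Since traces factor over
  Kronecker products, the common target noise and the independent agent noises each contribute n
  times a single-agent term, and 1/n cancels this.\<close>

lemma optimal_cost_eq:
  fixes A F G Q X1 :: "real^'d^'d" and B :: "real^'m^'d" and R :: "real^'m^'m"
  assumes "pos_semidef Q" and "pos_def R" and "observable A Q"
    and "pd_riccati_solution A (B ** matrix_inv R ** transpose B) Q X1"
  shows "optimal_cost TYPE('n::finite) A B F G Q R \<epsilon>
            = trace ((G ** transpose G + \<epsilon> *\<^sub>R (F ** transpose F)) ** X1)"
proof -
  have ones: "trace (ones_mat :: real^'n^'n) = real CARD('n)"
    by (simp add: ones_mat_def ones_col_def trace_def matrix_matrix_mult_def transpose_def)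
  have I: "trace (mat 1 :: real^'n^'n) = real CARD('n)"
    by (simp add: trace_I)
  have sc: "trace (c *\<^sub>R M) = c * trace M" for c and M :: "real^'k^'k"
    by (simp add: trace_def sum_distrib_left)
  show ?thesis
    unfolding optimal_cost_def Let_def group_X_eq[OF assms]
    by (simp add: scalar_matrix_assoc[symmetric] matrix_scalar_ac matrix_add_mult_rdistrib
        kron_mult trace_kron trace_add sc ones I field_simps)
qed

theorem mainTheorem3:
  fixes A F G Q X1 :: "real^'d^'d" and B :: "real^'m^'d" and R :: "real^'m^'m" and \<epsilon> :: real
  assumes "pos_semidef Q" and "pos_def R"
    and "controllable A B" and "observable A Q"
    and "\<epsilon> \<ge> 0"
    and "unique_pd_riccati_solution A (B ** matrix_inv R ** transpose B) Q X1"
  shows "unique_pd_riccati_solution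
           ((mat 1 :: real^'n^'n) \<otimes>\<^sub>K A)
           (real CARD('n) *\<^sub>R (((mat 1 :: real^'n^'n) \<otimes>\<^sub>K B)
              ** matrix_inv ((mat 1 :: real^'n^'n) \<otimes>\<^sub>K R)
              ** transpose ((mat 1 :: real^'n^'n) \<otimes>\<^sub>K B)))
           ((1 / real CARD('n)) *\<^sub>R ((mat 1 :: real^'n^'n) \<otimes>\<^sub>K Q))
           ((1 / real CARD('n)) *\<^sub>R ((mat 1 :: real^'n^'n) \<otimes>\<^sub>K X1))
       \<and> (\<forall>x :: real^('n \<times> 'd).
            optimal_control A B Q R x
              = - (((mat 1 :: real^'n^'n) \<otimes>\<^sub>K (matrix_inv R ** transpose B ** X1)) *v x)
            \<and> (\<forall>i. agent_block i (optimal_control A B Q R x)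
                  = - ((matrix_inv R ** transpose B ** X1) *v agent_block i x)))
       \<and> optimal_cost TYPE('n) A B F G Q R \<epsilon>
            = trace ((G ** transpose G + \<epsilon> *\<^sub>R (F ** transpose F)) ** X1)
       \<and> trace ((G ** transpose G + \<epsilon> *\<^sub>R (F ** transpose F)) ** X1)
            = optimal_cost TYPE(1) A B F G Q R \<epsilon>"
proof -
  have X1: "pd_riccati_solution A (B ** matrix_inv R ** transpose B) Q X1"
    using assms(6) by (simp add: unique_pd_riccati_solution_def)
  note hyps = assms(1,2,4) X1
  \<comment> \<open>The gain's factor n cancels the 1/n in \<open>group_X\<close>, and the remaining
    product multiplies inside the blocks.\<close>
  have ctrl: "optimal_control A B Q R x
      = - (((mat 1 :: real^'n^'n) \<otimes>\<^sub>K (matrix_inv R ** transpose B ** X1)) *v x)"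
    for x :: "real^('n \<times> 'd)"
    by (simp add: optimal_control_def Let_def group_X_eq[OF hyps] transpose_kron kron_mult
        matrix_inv_kron_mat_1[OF pos_def_invertible[OF assms(2)]] scalar_matrix_assoc[symmetric] matrix_scalar_ac)
  show ?thesis
    \<comment> \<open>\<open>optimal_cost_eq\<close> is used at both \<open>'n\<close> and the
      one-element type; its right-hand side does not involve the number of agents.\<close>
    using unique_group_riccati_solution[OF hyps, where 'n='n]
        by (simp add: ctrl group_S_def group_Q_def Let_def optimal_cost_eq[OF hyps]
        linear_neg[OF agent_block_linear] agent_block_kron del: transpose_matrix_vector)
qed

end
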